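(* Let $n\ge 1$, let $c>0$, $r>\sqrt{n}$, and let $\varepsilon>0$ be fixed. Let $\Pi:\mathbb{R}^n\to\mathbb{R}$ be a polynomial function expressed as a (finite) sum of monomials $$\Pi(V)=\sum_{\alpha}c_\alpha V^\alpha,\qquad V^\alpha=\prod_{i=1}^n v_i^{\alpha_i},$$ where $\alpha=(\alpha_1,\dots,\alpha_n)$ denotes the (nonnegative integer) exponents and $c_\alpha\in\mathbb{R}$ the coefficient of the monomial $V^\alpha$, and let $|\alpha|=\sum_{i=1}^n\alpha_i$. Let $J_\varepsilon$ be the functional $$V\mapsto \frac{1}{4\varepsilon}\|V\circ V-\mathbf{1}\|_2^2+\frac{c}{2}\|V\|_2^2+\Pi(V)$$ on $\mathbb{R}^n$, let $U_\varepsilon$ be a minimizer of $J_\varepsilon$ over the set $\overline{B}(0;r)$, and denote by $\delta$ the Euclidean distance from $U_\varepsilon$ to the set $\{\pm1\}^n$. Then $$\delta\le\frac{4\varepsilon}{1+2c\varepsilon}\,(c+L_r)\sqrt{n},$$ where $$L_r=\max_{i\in\{1,\dots,n\}}\sum_{\alpha}|c_\alpha|\,|\alpha_i|\,r^{|\alpha|-1}.$$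
   Context: $V\circ V=(v_i^2)_{i=1}^n$ is the Hadamard (componentwise) product, $\mathbf{1}=(1,\dots,1)\in\mathbb{R}^n$, $\|\cdot\|_2$ is the Euclidean norm, and $\overline{B}(0;r)$ is the closed Euclidean ball of radius $r$ centered at the origin of $\mathbb{R}^n$. *)

theory Defs
  imports "HOL-Analysis.Analysis"
begin

definition monomial :: "('n::finite \<Rightarrow> nat) \<Rightarrow> real ^ 'n \<Rightarrow> real" where
  "monomial \<alpha> V = (\<Prod>i\<in>UNIV. (V $ i) ^ \<alpha> i)"

definition total_deg :: "('n::finite \<Rightarrow> nat) \<Rightarrow> nat" where
  "total_deg \<alpha> = (\<Sum>i\<in>UNIV. \<alpha> i)"

(* On real ^ 'n the library's * is the componentwise product and 1 is the vector
   with all entries 1. *)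
definition J :: "real \<Rightarrow> real \<Rightarrow> (real ^ 'n::finite \<Rightarrow> real) \<Rightarrow> real ^ 'n \<Rightarrow> real" where
  "J \<epsilon> c P V =
     1 / (4 * \<epsilon>) * (norm (V * V - 1))\<^sup>2 + c / 2 * (norm V)\<^sup>2 + P V"

definition sign_vectors :: "(real ^ 'n) set" where
  "sign_vectors = {V. \<forall>i. V $ i \<in> {-1, 1}}"

(* The exponent of r is an integer: for the constant monomial it equals -1,
   and there the factor \<alpha> i = 0 makes the term vanish. *)
definition L :: "('n::finite \<Rightarrow> nat) set \<Rightarrow> (('n \<Rightarrow> nat) \<Rightarrow> real) \<Rightarrow> real \<Rightarrow> real" where
  "L A a r =
     (MAX i\<in>UNIV. \<Sum>\<alpha>\<in>A. \<bar>a \<alpha>\<bar> * real (\<alpha> i) * r powi (int (total_deg \<alpha>) - 1))"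

end

theory Submission
  imports Defs
begin

text \<open>
  The minimizer \<open>U\<close> is compared with a single competitor, the vector \<open>S\<close> of the signs of its
  coordinates. Its norm is \<open>\<surd>n < r\<close>, so it lies in the ball and \<open>J U \<le> J S\<close>. At a sign vector the
  double-well term vanishes, while at \<open>U\<close> it controls the distance \<open>d = U - S\<close>: with \<open>a = \<bar>U $ i\<bar>\<close>,
  the \<open>i\<close>-th summand is \<open>(a\<^sup>2 - 1)\<^sup>2 = (a - 1)\<^sup>2 (a + 1)\<^sup>2 \<ge> (a - 1)\<^sup>2 = (d $ i)\<^sup>2\<close>. The quadratic term
  contributes \<open>a\<^sup>2 - 1 = (a - 1)\<^sup>2 + 2 (a - 1) \<ge> (d $ i)\<^sup>2 - 2 \<bar>d $ i\<bar>\<close>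
  (lemma \<open>double_well_excess\<close>). Hence
  \<open>(1 / (4 \<epsilon>) + c / 2) \<parallel>d\<parallel>\<^sup>2 \<le> c \<parallel>d\<parallel>\<^sub>1 + (P S - P U)\<close>.
  On the cube of half-width \<open>r\<close>, which contains the ball, the number \<open>L A a r\<close> bounds every partial
  derivative of \<open>P\<close>, so \<open>P S - P U \<le> L A a r * \<parallel>d\<parallel>\<^sub>1\<close> (lemma \<open>polynomial_diff_le_L\<close>).
  With \<open>\<parallel>d\<parallel>\<^sub>1 \<le> \<surd>n \<parallel>d\<parallel>\<close> (Cauchy--Schwarz), cancelling one factor \<open>\<parallel>d\<parallel>\<close> bounds \<open>\<parallel>d\<parallel>\<close>, hence the
  distance from \<open>U\<close> to the set of sign vectors, by the asserted quantity.
\<close>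

section \<open>A Lipschitz estimate for polynomials on a cube\<close>

text \<open>
  Dividing \<open>r ^ k\<close> by \<open>r\<close> instead of writing \<open>r ^ (k - 1)\<close> makes the case \<open>k = 0\<close> uniform and lets
  the factors \<open>r ^ k\<close> multiply up in products.
\<close>

lemma abs_power_diff_le:
  fixes x y r :: real
  assumes "r > 0" and "\<bar>x\<bar> \<le> r" and "\<bar>y\<bar> \<le> r"
  shows "\<bar>x ^ k - y ^ k\<bar> \<le> \<bar>x - y\<bar> * (real k * (r ^ k / r))"
proof (induction k)
  case 0
  then show ?case by simp
next
  case (Suc k)
  have "\<bar>x ^ Suc k - y ^ Suc k\<bar> = \<bar>x * (x ^ k - y ^ k) + (x - y) * y ^ k\<bar>"
    by (simp add: algebra_simps)
  also have "\<dots> \<le> \<bar>x\<bar> * \<bar>x ^ k - y ^ k\<bar> + \<bar>x - y\<bar> * \<bar>y\<bar> ^ k"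
    by (rule order_trans[OF abs_triangle_ineq]) (simp add: abs_mult power_abs)
  also have "\<dots> \<le> r * (\<bar>x - y\<bar> * (real k * (r ^ k / r))) + \<bar>x - y\<bar> * r ^ k"
    using assms Suc by (intro add_mono mult_mono power_mono) auto
  also have "\<dots> = \<bar>x - y\<bar> * (real (Suc k) * (r ^ Suc k / r))"
    using assms by (simp add: field_simps)
  finally show ?case .
qed

text \<open>
  Exchanging the coordinates one at a time keeps all intermediate points in the cube, so each
  exchange costs at most the one-dimensional bound times the size of the remaining factors.
\<close>

lemma abs_prod_power_diff_le:
  fixes x y :: "'a \<Rightarrow> real" and \<alpha> :: "'a \<Rightarrow> nat"
  assumes "finite I" and "r > 0"
    and "\<And>i. i \<in> I \<Longrightarrow> \<bar>x i\<bar> \<le> r" and "\<And>i. i \<in> I \<Longrightarrow> \<bar>y i\<bar> \<le> r"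
  shows "\<bar>(\<Prod>i\<in>I. x i ^ \<alpha> i) - (\<Prod>i\<in>I. y i ^ \<alpha> i)\<bar>
           \<le> (\<Sum>i\<in>I. \<bar>x i - y i\<bar> * real (\<alpha> i)) * (r ^ sum \<alpha> I / r)"
  using assms(1,3,4)
proof (induction I rule: finite_induct)
  case empty
  then show ?case by simp
next
  case (insert j I)
  let ?X = "\<Prod>i\<in>I. x i ^ \<alpha> i" and ?Y = "\<Prod>i\<in>I. y i ^ \<alpha> i"
  let ?R = "r ^ sum \<alpha> I" and ?T = "\<Sum>i\<in>I. \<bar>x i - y i\<bar> * real (\<alpha> i)"
  have Y: "\<bar>?Y\<bar> \<le> ?R"
    unfolding abs_prod power_sum
    by (rule prod_mono) (use insert in \<open>auto simp: power_abs power_mono\<close>)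
  have "\<bar>x j ^ \<alpha> j * ?X - y j ^ \<alpha> j * ?Y\<bar>
      = \<bar>x j ^ \<alpha> j * (?X - ?Y) + (x j ^ \<alpha> j - y j ^ \<alpha> j) * ?Y\<bar>"
    by (simp add: algebra_simps)
  also have "\<dots> \<le> \<bar>x j\<bar> ^ \<alpha> j * \<bar>?X - ?Y\<bar> + \<bar>x j ^ \<alpha> j - y j ^ \<alpha> j\<bar> * \<bar>?Y\<bar>"
    by (rule order_trans[OF abs_triangle_ineq]) (simp add: abs_mult power_abs)
  also have "\<dots> \<le> r ^ \<alpha> j * (?T * (?R / r)) + \<bar>x j - y j\<bar> * (real (\<alpha> j) * (r ^ \<alpha> j / r)) * ?R"
    using insert assms(2) Y
    by (intro add_mono mult_mono power_mono abs_power_diff_le) (auto intro!: sum_nonneg)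
  also have "\<dots> = (\<bar>x j - y j\<bar> * real (\<alpha> j) + ?T) * (r ^ (\<alpha> j + sum \<alpha> I) / r)"
    by (simp add: algebra_simps add_divide_distrib power_add)
  finally show ?case
    using insert(1,2) by simp
qed

text \<open>
  Interchanging the two sums collects, for each coordinate \<open>i\<close>, the bound on the \<open>i\<close>-th partial
  derivative, of which \<open>L\<close> is the maximum.
\<close>

lemma polynomial_diff_le_L:
  fixes x y :: "real ^ 'n::finite"
  assumes "r > 0" and "\<And>i. \<bar>x $ i\<bar> \<le> r" and "\<And>i. \<bar>y $ i\<bar> \<le> r"
  shows "\<bar>(\<Sum>\<alpha>\<in>A. a \<alpha> * monomial \<alpha> x) - (\<Sum>\<alpha>\<in>A. a \<alpha> * monomial \<alpha> y)\<bar>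
           \<le> L A a r * (\<Sum>i\<in>UNIV. \<bar>x $ i - y $ i\<bar>)"
proof -
  let ?w = "\<lambda>\<alpha>. r powi (int (total_deg \<alpha>) - 1)"
  let ?D = "\<lambda>i. \<Sum>\<alpha>\<in>A. \<bar>a \<alpha>\<bar> * real (\<alpha> i) * ?w \<alpha>"
  have w: "?w \<alpha> = r ^ sum \<alpha> UNIV / r" for \<alpha> :: "'n \<Rightarrow> nat"
    using assms(1)
    by (simp add: power_int_diff flip: total_deg_def)
  have mono: "\<bar>monomial \<alpha> x - monomial \<alpha> y\<bar> \<le> (\<Sum>i\<in>UNIV. \<bar>x $ i - y $ i\<bar> * real (\<alpha> i)) * ?w \<alpha>"
    for \<alpha> unfolding monomial_def w by (rule abs_prod_power_diff_le) (use assms in auto)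
  have "\<bar>(\<Sum>\<alpha>\<in>A. a \<alpha> * monomial \<alpha> x) - (\<Sum>\<alpha>\<in>A. a \<alpha> * monomial \<alpha> y)\<bar>
      = \<bar>\<Sum>\<alpha>\<in>A. a \<alpha> * (monomial \<alpha> x - monomial \<alpha> y)\<bar>"
    by (simp add: sum_subtractf right_diff_distrib)
  also have "\<dots> \<le> (\<Sum>\<alpha>\<in>A. \<bar>a \<alpha>\<bar> * \<bar>monomial \<alpha> x - monomial \<alpha> y\<bar>)"
    using sum_abs[of "\<lambda>\<alpha>. a \<alpha> * (monomial \<alpha> x - monomial \<alpha> y)" A] by (simp add: abs_mult)
  also have "\<dots> \<le> (\<Sum>\<alpha>\<in>A. \<bar>a \<alpha>\<bar> * ((\<Sum>i\<in>UNIV. \<bar>x $ i - y $ i\<bar> * real (\<alpha> i)) * ?w \<alpha>))"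
    by (intro sum_mono mult_left_mono mono) auto
  also have "\<dots> = (\<Sum>\<alpha>\<in>A. \<Sum>i\<in>UNIV. \<bar>a \<alpha>\<bar> * real (\<alpha> i) * ?w \<alpha> * \<bar>x $ i - y $ i\<bar>)"
    by (simp add: sum_distrib_left sum_distrib_right ac_simps)
  also have "\<dots> = (\<Sum>i\<in>UNIV. ?D i * \<bar>x $ i - y $ i\<bar>)"
    by (subst sum.swap) (simp add: sum_distrib_right)
  also have "\<dots> \<le> (\<Sum>i\<in>UNIV. L A a r * \<bar>x $ i - y $ i\<bar>)"
    unfolding L_def by (intro sum_mono mult_right_mono Max_ge) auto
  finally show ?thesis
    by (simp add: sum_distrib_left)
qed

section \<open>The penalty terms and the sign vector\<close>

lemma norm_power2_eq_sum_cart: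
  fixes x :: "real ^ 'n::finite"
  shows "(norm x)\<^sup>2 = (\<Sum>i\<in>UNIV. (x $ i)\<^sup>2)"
  by (simp add: norm_vec_def L2_set_def sum_nonneg)

lemma sum_abs_le_sqrt_card_norm:
  fixes x :: "real ^ 'n::finite"
  shows "(\<Sum>i\<in>UNIV. \<bar>x $ i\<bar>) \<le> sqrt (real CARD('n)) * norm x"
  using L2_set_mult_ineq[of "\<lambda>i. 1" "\<lambda>i. x $ i" UNIV]
  by (simp add: norm_vec_def L2_set_def)

lemma norm_sign_vector:
  fixes S :: "real ^ 'n::finite"
  assumes "S \<in> sign_vectors"
  shows "norm S = sqrt (real CARD('n))"
proof -
  have "(S $ i)\<^sup>2 = 1" for i
    using assms by (auto simp: sign_vectors_def power2_eq_1_iff)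
  then have "(norm S)\<^sup>2 = real CARD('n)"
    by (simp add: norm_power2_eq_sum_cart)
  then show ?thesis
    by (metis norm_ge_zero real_sqrt_unique)
qed

text \<open>
  The hypothesis \<open>s * u \<ge> 0\<close> says that \<open>s\<close> is a sign of \<open>u\<close>, so that \<open>\<bar>u - s\<bar> = \<bar>\<bar>u\<bar> - 1\<bar>\<close> and the
  factor \<open>\<bar>u\<bar> + 1\<close> of \<open>u\<^sup>2 - 1\<close> is at least \<open>1\<close>.
\<close>

lemma double_well_excess:
  fixes u s p q :: real
  assumes "s \<in> {-1, 1}" and "s * u \<ge> 0" and "p \<ge> 0" and "q \<ge> 0"
  shows "(p + q) * (u - s)\<^sup>2 - 2 * q * \<bar>u - s\<bar> \<le> p * (u\<^sup>2 - 1)\<^sup>2 + q * (u\<^sup>2 - 1)"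
proof -
  have s: "s\<^sup>2 = 1"
    using assms(1) by auto
  have "\<bar>u + s\<bar> \<ge> 1"
    using assms(1,2) by auto
  then have "1 * (u - s)\<^sup>2 \<le> (u + s)\<^sup>2 * (u - s)\<^sup>2"
    by (intro mult_right_mono) (auto simp: abs_le_square_iff[of 1, simplified])
  also have "\<dots> = (u\<^sup>2 - 1)\<^sup>2"
    by (metis power_mult_distrib s square_diff_square_factored power2_eq_square)
  finally have well: "p * (u - s)\<^sup>2 \<le> p * (u\<^sup>2 - 1)\<^sup>2"
    using assms(3) by (simp add: mult_left_mono)
  have "u\<^sup>2 - 1 = (u - s)\<^sup>2 + 2 * (s * (u - s))"
    using s by (simp add: power2_eq_square algebra_simps)
  moreover have "- \<bar>u - s\<bar> \<le> s * (u - s)"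
    using assms(1) by auto
  ultimately have "q * ((u - s)\<^sup>2 - 2 * \<bar>u - s\<bar>) \<le> q * (u\<^sup>2 - 1)"
    using assms(4) by (intro mult_left_mono) auto
  with well show ?thesis
    by (simp add: algebra_simps)
qed

text \<open>
  The constant \<open>c / 2 * n\<close>, the quadratic term of a sign vector, is split off so that all
  remaining summands vanish at sign vectors.
\<close>

lemma J_eq_sum:
  fixes V :: "real ^ 'n::finite"
  shows "J \<epsilon> c P V
    = (\<Sum>i\<in>UNIV. 1 / (4 * \<epsilon>) * ((V $ i)\<^sup>2 - 1)\<^sup>2 + c / 2 * ((V $ i)\<^sup>2 - 1))
      + c / 2 * real CARD('n) + P V"
proof -
  have "(norm (V * V - 1))\<^sup>2 = (\<Sum>i\<in>UNIV. ((V $ i)\<^sup>2 - 1)\<^sup>2)"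
    by (simp add: norm_power2_eq_sum_cart power2_eq_square[of "V $ _"])
  then show ?thesis
    unfolding J_def norm_power2_eq_sum_cart[of V]
    by (simp add: sum.distrib sum_subtractf right_diff_distrib
        flip: sum_distrib_left sum_divide_distrib)
qed

section \<open>The distance of a minimizer to the sign vectors\<close>

theorem theorem3:
  fixes c r \<epsilon> :: real
    and P :: "real ^ 'n::finite \<Rightarrow> real"
    and A :: "('n \<Rightarrow> nat) set"
    and a :: "('n \<Rightarrow> nat) \<Rightarrow> real"
    and U :: "real ^ 'n"
  assumes "c > 0" and "r > sqrt (real CARD('n))" and "\<epsilon> > 0"
    and "finite A"
    and "\<And>V. P V = (\<Sum>\<alpha>\<in>A. a \<alpha> * monomial \<alpha> V)"
    and "is_arg_min (J \<epsilon> c P) (\<lambda>V. V \<in> cball 0 r) U"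
  shows "infdist U sign_vectors
           \<le> 4 * \<epsilon> / (1 + 2 * c * \<epsilon>) * (c + L A a r) * sqrt (real CARD('n))"
proof -
  define S :: "real ^ 'n" where "S = (\<chi> i. if U $ i \<ge> 0 then 1 else - 1)"
  define d where "d = U - S"
  let ?n = "sqrt (real CARD('n))" and ?d1 = "\<Sum>i\<in>UNIV. \<bar>d $ i\<bar>"
  let ?p = "1 / (4 * \<epsilon>)" and ?q = "c / 2"
  have S: "S \<in> sign_vectors"
    by (simp add: S_def sign_vectors_def)
  have r: "r > 0"
    using assms(2) by (meson of_nat_0_le_iff order_le_less_trans real_sqrt_ge_zero)
  have normS: "norm S \<le> r"
    using norm_sign_vector[OF S] assms(2) by simp
  have normU: "norm U \<le> r" and le: "J \<epsilon> c P U \<le> J \<epsilon> c P S"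
    using assms(6) normS by (auto simp: is_arg_min_linorder)

  have lip: "P S - P U \<le> L A a r * ?d1"
  proof -
    have "\<bar>P U - P S\<bar> \<le> L A a r * (\<Sum>i\<in>UNIV. \<bar>U $ i - S $ i\<bar>)"
      unfolding assms(5) using r normS normU
      by (intro polynomial_diff_le_L) (auto intro: order_trans[OF component_le_norm_cart])
    then show ?thesis
      by (simp add: d_def)
  qed
  have "(\<Sum>i\<in>UNIV. (?p + ?q) * (d $ i)\<^sup>2 - 2 * ?q * \<bar>d $ i\<bar>)
      \<le> (\<Sum>i\<in>UNIV. ?p * ((U $ i)\<^sup>2 - 1)\<^sup>2 + ?q * ((U $ i)\<^sup>2 - 1))"
    unfolding d_def vector_minus_component using assms(1,3)
    by (intro sum_mono double_well_excess) (auto simp: S_def)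
  moreover have "(S $ i)\<^sup>2 = 1" for i
    by (simp add: S_def)
  ultimately have "(?p + ?q) * (norm d)\<^sup>2 - c * ?d1 \<le> P S - P U"
    using le by (simp add: J_eq_sum norm_power2_eq_sum_cart sum_subtractf sum_distrib_left)
  with lip have main: "(?p + ?q) * (norm d)\<^sup>2 \<le> (c + L A a r) * ?d1"
    by (simp add: algebra_simps)

  have L_nonneg: "L A a r \<ge> 0"
  proof -
    \<comment> \<open>Here \<open>undefined\<close> is an arbitrary index: each entry of the maximum is nonnegative.\<close>
    have "0 \<le> (\<Sum>\<alpha>\<in>A. \<bar>a \<alpha>\<bar> * real (\<alpha> undefined) * r powi (int (total_deg \<alpha>) - 1))"
      using r by (intro sum_nonneg) auto
    also have "\<dots> \<le> L A a r"
      unfolding L_def by (intro Max_ge) auto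
    finally show ?thesis .
  qed
  have "(?p + ?q) * (norm d)\<^sup>2 \<le> (c + L A a r) * (?n * norm d)"
    using main assms(1) L_nonneg
    by (elim order_trans) (intro mult_left_mono sum_abs_le_sqrt_card_norm, simp)
  then have "(?p + ?q) * norm d \<le> (c + L A a r) * ?n"
    using assms(1) L_nonneg by (cases "norm d = 0") (auto simp: power2_eq_square)
  moreover have "?p + ?q = (1 + 2 * c * \<epsilon>) / (4 * \<epsilon>)"
    using assms(3) by (simp add: field_simps)
  ultimately have "norm d \<le> 4 * \<epsilon> / (1 + 2 * c * \<epsilon>) * (c + L A a r) * ?n"
    using assms(1,3) by (simp add: field_simps add_pos_pos)
  moreover have "infdist U sign_vectors \<le> norm d"
    unfolding d_def using infdist_le[OF S, of U] by (simp add: dist_norm)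
  ultimately show ?thesis
    by simp
qed

end
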